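(* Let $f:\mathbb{R}^d\to\mathbb{R}$ be glocally $(L,L_*,\delta)$-smooth and $\mu$-strongly convex with $\mu>0$, with minimizer $w_*$ and $f_*=f(w_* )$. Let $w_0\in\mathbb{R}^d$ and let $\epsilon$ satisfy $f(w_0)-f_*>\delta>\epsilon>0$. For all $t\ge0$ let $$w_{t+1}=w_t-\eta_t\nabla f(w_t),\qquad \eta_t=\frac{f(w_t)-f_*}{\|\nabla f(w_t)\|^2}.$$ Then $f(w_T)-f_*\le\epsilon$ for all integers $T$ with $$T\ge 4\left(\frac{L}{\mu}\log\left(\frac{L}{2}\frac{\|w_0-w_*\|^2}{\delta}\right)+\frac{L_*}{\mu}\log\left(\frac{L_*}{L}\frac{\delta}{\epsilon}\right)\right)+1.$$
   Context: $\|\cdot\|$ is the Euclidean norm, functions are differentiable, and $L,L_*,\delta>0$. If $\nabla f(w_t)=0$ then $w_{t+1}=w_t$. Glocal smoothness: $f$ with infimum $f_*$ is glocally $(L,L_*,\delta)$-smooth if (i) $\|\nabla f(u)-\nabla f(v)\|\le L\|u-v\|$ for all $u,v\in\mathbb{R}^d$, and (ii) $\|\nabla f(u)-\nabla f(v)\|\le L_*\|u-v\|$ for all $u,v$ in the set $\{u: f(u)-f_*\le\delta\}$. Strong convexity: $f$ is $\mu$-strongly convex if $f(v)\ge f(u)+\langle\nabla f(u),v-u\rangle+\frac{\mu}{2}\|v-u\|^2$ for all $u,v\in\mathbb{R}^d$. *)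

theory Defs
  imports "HOL-Analysis.Analysis"
begin

(* Meaningful only where f is differentiable; see gderiv_gradient. *)
definition gradient :: "('a::euclidean_space \<Rightarrow> real) \<Rightarrow> 'a \<Rightarrow> 'a" where
  "gradient f x = (THE D. GDERIV f x :> D)"

lemma gradient_eqI:
  assumes "GDERIV f x :> D"
  shows "gradient f x = D"
  unfolding gradient_def
proof (rule the_equality[where P = "\<lambda>D. GDERIV f x :> D", OF assms])
  fix D' assume "GDERIV f x :> D'"
  with assms have "(\<lambda>h. inner h D') = (\<lambda>h. inner h D)"
    unfolding gderiv_def by (rule has_derivative_unique[rotated])
  then show "D' = D"
    by (metis vector_eq_rdot inner_commute)
qed

lemma gderiv_gradient:
  assumes "f differentiable (at x)"
  shows "GDERIV f x :> gradient f x"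
proof -
  obtain f' where f': "(f has_derivative f') (at x)"
    using assms unfolding differentiable_def by blast
  then have lin: "linear f'"
    by (rule has_derivative_linear)
  have "f' = (\<lambda>h. inner h (adjoint f' 1))"
    using adjoint_works[OF lin, of _ 1] by (simp add: fun_eq_iff)
  with f' have "GDERIV f x :> adjoint f' 1"
    unfolding gderiv_def by metis
  then show ?thesis
    using gradient_eqI by metis
qed

(* The bdd_below conjunct says that the infimum of f is a real number; without it
   INF would be unspecified. *)
definition glocally_smooth ::
  "('a::euclidean_space \<Rightarrow> real) \<Rightarrow> real \<Rightarrow> real \<Rightarrow> real \<Rightarrow> bool" where
  "glocally_smooth f L Ls \<delta> \<longleftrightarrow>
     bdd_below (range f) \<and>
     (\<forall>u v. norm (gradient f u - gradient f v) \<le> L * norm (u - v)) \<and>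
     (\<forall>u\<in>{u. f u - (INF x. f x) \<le> \<delta>}. \<forall>v\<in>{u. f u - (INF x. f x) \<le> \<delta>}.
        norm (gradient f u - gradient f v) \<le> Ls * norm (u - v))"

definition strongly_convex :: "real \<Rightarrow> ('a::euclidean_space \<Rightarrow> real) \<Rightarrow> bool" where
  "strongly_convex \<mu> f \<longleftrightarrow>
     (\<forall>u v. f v \<ge> f u + inner (gradient f u) (v - u) + \<mu> / 2 * (norm (v - u))\<^sup>2)"

end

theory Submission
  imports Defs
begin

text \<open>
  Write \<open>h t = f (w t) - fstar\<close>, \<open>g t = gradient f (w t)\<close> and \<open>D t\<close> for the squared distance
  of \<open>w t\<close> to the minimizer. Expanding the square and using strong convexity, a Polyak step gives
  \<open>D (Suc t) \<le> D t - \<eta> t * (h t + \<mu> * D t)\<close>. Strong convexity also bounds \<open>h t\<close> below by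
  \<open>\<mu> / 2 * D t\<close>, and if the gradient is \<open>K\<close>-Lipschitz on a sublevel set containing \<open>w t\<close>, then
  \<open>(norm (g t))\<^sup>2 \<le> 2 * K * h t\<close>, that is, \<open>\<eta> t \<ge> 1 / (2 * K)\<close>. So every step contracts \<open>D\<close> by
  \<open>exp (- 3 * \<mu> / (4 * K))\<close> (lemma \<open>polyak_step_contraction\<close>): always with \<open>K = L\<close>, and with
  \<open>K = Ls\<close> while the gap is at most \<open>\<delta>\<close>.

  The gap itself need not decrease, but \<open>D\<close> does, so all thresholds are put on \<open>D\<close>. The
  conversion back is lemma \<open>gap_le_if_near_minimizer\<close>: if \<open>D \<le> 2 * \<epsilon> / Ls\<close> then the gap is at most
  \<open>\<epsilon>\<close>, although the point is not known beforehand to lie in the region where \<open>Ls\<close> is valid. A segment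
  from the minimizer that reached a larger gap would cross the level \<open>\<epsilon>\<close> earlier, inside that region,
  and at squared distance at least \<open>2 * \<epsilon> / Ls\<close>.

  It remains to count steps. With \<open>A = L * D 0 / (2 * \<delta>)\<close> and \<open>x = Ls * \<delta> / (L * \<epsilon>)\<close>, the target
  is \<open>2 * \<epsilon> / Ls = D 0 / A / x\<close>. If \<open>x \<ge> 1\<close>, the rate of \<open>L\<close> brings \<open>D\<close> down to
  \<open>D 0 / A = 2 * \<delta> / L\<close>; from there on the gap stays at most \<open>\<delta>\<close> by \<open>L\<close>-smoothness, and the rate of
  \<open>Ls\<close> gains the factor \<open>x\<close>. If \<open>x < 1\<close>, the second logarithm is negative and shortens the
  permitted number of steps. Then the rate of \<open>L\<close> alone suffices, because the initial gap above \<open>\<delta>\<close>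
  forces \<open>D 0 > 2 * \<delta> / Ls\<close>, so that \<open>A\<close> is at least \<open>L / Ls\<close> and \<open>ln A\<close> outweighs
  the negative term.
\<close>

text \<open>
  One predicate covers both smoothness hypotheses: the global one is the case of arbitrary \<open>c\<close>,
  the local one has \<open>c = fstar + \<delta>\<close>.
\<close>

definition lipschitz_gradient_below ::
  "('a::euclidean_space \<Rightarrow> real) \<Rightarrow> real \<Rightarrow> real \<Rightarrow> bool" where
  "lipschitz_gradient_below f K c \<longleftrightarrow>
     (\<forall>u v. f u \<le> c \<longrightarrow> f v \<le> c \<longrightarrow>
        norm (gradient f u - gradient f v) \<le> K * norm (u - v))"

section \<open>Functions along a segment\<close>

lemma has_real_derivative_along_line:
  fixes f :: "'a::euclidean_space \<Rightarrow> real"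
  assumes "\<And>x. f differentiable (at x)"
  shows "((\<lambda>s. f (u + s *\<^sub>R d)) has_real_derivative
           inner (gradient f (u + s *\<^sub>R d)) d) (at s)"
proof -
  have f: "(f has_derivative (\<lambda>h. inner h (gradient f (u + s *\<^sub>R d)))) (at (u + s *\<^sub>R d))"
    using gderiv_gradient[OF assms] unfolding gderiv_def .
  have "((\<lambda>s. u + s *\<^sub>R d) has_derivative (\<lambda>h. h *\<^sub>R d)) (at s)"
    by (auto intro!: derivative_eq_intros)
  from has_derivative_compose[OF this f] show ?thesis
    by (simp add: has_field_derivative_def inner_commute[of d] mult_commute_abs)
qed

lemma continuous_on_line:
  fixes f :: "'a::euclidean_space \<Rightarrow> real"
  assumes "\<And>x. f differentiable (at x)"
  shows "continuous_on S (\<lambda>s. f (u + s *\<^sub>R d))"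
  using has_real_derivative_along_line[OF assms]
  by (meson DERIV_isCont continuous_at_imp_continuous_on)

lemma strongly_convex_gradient_inequality:
  assumes "strongly_convex \<mu> f" "\<mu> > 0"
  shows "f v \<ge> f u + inner (gradient f u) (v - u)"
proof -
  have "f v \<ge> f u + inner (gradient f u) (v - u) + \<mu> / 2 * (norm (v - u))\<^sup>2"
    using assms(1) unfolding strongly_convex_def by blast
  moreover have "\<mu> / 2 * (norm (v - u))\<^sup>2 \<ge> 0" using assms(2) by simp
  ultimately show ?thesis by linarith
qed

lemma segment_in_sublevel_set:
  fixes f :: "'a::euclidean_space \<Rightarrow> real"
  assumes convex: "\<And>u v. f v \<ge> f u + inner (gradient f u) (v - u)"
    and ends: "f u \<le> c" "f (u + d) \<le> c" and s: "0 \<le> s" "s \<le> 1"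
  shows "f (u + s *\<^sub>R d) \<le> c"
proof -
  define z where "z = u + s *\<^sub>R d"
  have "f z - s * inner (gradient f z) d \<le> c"
    using convex[of z u] ends(1) by (simp add: z_def)
  moreover have "f z + (1 - s) * inner (gradient f z) d \<le> c"
    using convex[of z "u + d"] ends(2) by (simp add: z_def algebra_simps inner_diff_right)
  ultimately have "(1 - s) * (f z - s * inner (gradient f z) d)
      + s * (f z + (1 - s) * inner (gradient f z) d) \<le> (1 - s) * c + s * c"
    using s by (intro add_mono mult_left_mono) auto
  then show ?thesis
    by (simp add: z_def algebra_simps)
qed

text \<open>
  The usual quadratic upper bound needs the Lipschitz condition only at pairs consisting of \<open>u\<close> and
  a point of the segment from \<open>u\<close> to \<open>u + d\<close>; by convexity the sublevel set contains this segment
  as soon as it contains the two ends.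
\<close>

lemma descent_in_sublevel_set:
  fixes f :: "'a::euclidean_space \<Rightarrow> real"
  assumes diff: "\<And>x. f differentiable (at x)"
    and convex: "\<And>u v. f v \<ge> f u + inner (gradient f u) (v - u)"
    and lip: "lipschitz_gradient_below f K c"
    and ends: "f u \<le> c" "f (u + d) \<le> c"
  shows "f (u + d) \<le> f u + inner (gradient f u) d + K / 2 * (norm d)\<^sup>2"
proof -
  define \<psi> where "\<psi> = (\<lambda>s. f (u + s *\<^sub>R d) - s * inner (gradient f u) d - K / 2 * (norm d)\<^sup>2 * s\<^sup>2)"
  have "\<psi> 1 \<le> \<psi> 0"
  proof (rule DERIV_nonpos_imp_nonincreasing[where f = \<psi>])
    fix s :: real assume s: "0 \<le> s" "s \<le> 1"
    let ?D = "inner (gradient f (u + s *\<^sub>R d)) d - inner (gradient f u) d - K * (norm d)\<^sup>2 * s"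
    have "(\<psi> has_real_derivative ?D) (at s)"
      unfolding \<psi>_def
      by (rule derivative_eq_intros has_real_derivative_along_line[OF diff] refl)+ simp
    moreover have "?D \<le> 0"
    proof -
      have "f (u + s *\<^sub>R d) \<le> c"
        using segment_in_sublevel_set[OF convex ends s] .
      then have "norm (gradient f (u + s *\<^sub>R d) - gradient f u) \<le> K * norm (s *\<^sub>R d)"
        using lip ends unfolding lipschitz_gradient_below_def by (metis add_diff_cancel_left')
      then have "norm (gradient f (u + s *\<^sub>R d) - gradient f u) * norm d \<le> K * norm (s *\<^sub>R d) * norm d"
        by (rule mult_right_mono) simp
      moreover have "inner (gradient f (u + s *\<^sub>R d) - gradient f u) d
          \<le> norm (gradient f (u + s *\<^sub>R d) - gradient f u) * norm d"
        by (rule norm_cauchy_schwarz)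
      ultimately show ?thesis
        using s by (simp add: inner_diff_left power2_eq_square mult_ac)
    qed
    ultimately show "\<exists>y. (\<psi> has_real_derivative y) (at s) \<and> y \<le> 0" by blast
  qed simp
  then show ?thesis by (simp add: \<psi>_def)
qed

text \<open>
  A gradient step of length \<open>1 / K\<close> decreases \<open>f\<close> by \<open>(norm (gradient f u))\<^sup>2 / (2 * K)\<close> and cannot
  go below \<open>m\<close>. For a condition that holds only on a sublevel set, this requires that the step does
  not leave the set. It does not: \<open>f\<close> first decreases along the step, so leaving would mean a return
  to the value \<open>f u\<close> at some point \<open>s \<le> 1 / K\<close>, where the quadratic bound still holds
  and gives a value below \<open>f u\<close>.
\<close>

lemma gradient_bound_in_sublevel_set:
  fixes f :: "'a::euclidean_space \<Rightarrow> real"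
  assumes diff: "\<And>x. f differentiable (at x)"
    and convex: "\<And>u v. f v \<ge> f u + inner (gradient f u) (v - u)"
    and lip: "lipschitz_gradient_below f K c" and K: "K > 0"
    and u: "f u \<le> c" and lower: "\<And>x. m \<le> f x"
  shows "(norm (gradient f u))\<^sup>2 \<le> 2 * K * (f u - m)"
proof (cases "gradient f u = 0")
  case True
  then show ?thesis using lower[of u] K by simp
next
  case False
  define g where "g = gradient f u"
  define \<phi> where "\<phi> = (\<lambda>s. f (u + s *\<^sub>R (- g)))"
  have g: "(norm g)\<^sup>2 > 0" using False by (simp add: g_def)
  have descent: "\<phi> s \<le> f u - s * (1 - K * s / 2) * (norm g)\<^sup>2" if "\<phi> s \<le> c" for s
    using descent_in_sublevel_set[OF diff convex lip u, of "s *\<^sub>R (- g)"] that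
    by (simp add: \<phi>_def g_def[symmetric] dot_square_norm power_mult_distrib algebra_simps)
       (simp add: power2_eq_square mult_ac)
  have "\<phi> (1 / K) \<le> f u"
  proof (rule ccontr)
    assume far: "\<not> \<phi> (1 / K) \<le> f u"
    have "(\<phi> has_real_derivative - (norm g)\<^sup>2) (at 0)"
      using has_real_derivative_along_line[OF diff, of u "- g" 0]
      by (simp add: \<phi>_def g_def[symmetric] power2_norm_eq_inner)
    from has_real_derivative_neg_dec_right[OF this] g obtain e where e: "e > 0"
      "\<And>h. h > 0 \<Longrightarrow> h < e \<Longrightarrow> \<phi> h < \<phi> 0"
      by auto
    define h where "h = min (e / 2) (1 / K)"
    have h: "h > 0" "h \<le> 1 / K" "\<phi> h < f u"
      using e K e(2)[of h] by (auto simp: h_def \<phi>_def)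
    have "continuous_on {h..1 / K} \<phi>"
      unfolding \<phi>_def by (rule continuous_on_line[OF diff])
    moreover have "f u \<le> \<phi> (1 / K)" using far by simp
    ultimately obtain s where s: "h \<le> s" "s \<le> 1 / K" "\<phi> s = f u"
      using IVT'[of \<phi> h "f u" "1 / K"] less_imp_le[OF h(3)] h(2) by blast
    have "K * s \<le> 1" using s(2) K by (simp add: field_simps)
    then have "s * (1 - K * s / 2) * (norm g)\<^sup>2 > 0"
      using h s g by (intro mult_pos_pos) auto
    with descent[of s] s(3) u show False by simp
  qed
  with descent[of "1 / K"] u have "\<phi> (1 / K) \<le> f u - 1 / (2 * K) * (norm g)\<^sup>2"
    using K by simp
  moreover have "m \<le> \<phi> (1 / K)" using lower by (simp add: \<phi>_def)
  ultimately have "1 / (2 * K) * (norm g)\<^sup>2 \<le> f u - m" by linarith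
  then show ?thesis using K by (simp add: g_def field_simps)
qed

section \<open>Values and distances near a minimizer\<close>

lemma gap_le_quadratic:
  fixes f :: "'a::euclidean_space \<Rightarrow> real"
  assumes diff: "\<And>x. f differentiable (at x)"
    and convex: "\<And>u v. f v \<ge> f u + inner (gradient f u) (v - u)"
    and lip: "lipschitz_gradient_below f K c" and K: "K > 0"
    and min: "\<And>x. f z \<le> f x" and x: "f x \<le> c"
  shows "f x - f z \<le> K / 2 * (norm (x - z))\<^sup>2"
proof -
  have z: "f z \<le> c" using min[of x] x by simp
  \<comment> \<open>The gradient bound with \<open>m = f z\<close> at the minimizer itself.\<close>
  have "gradient f z = 0"
    using gradient_bound_in_sublevel_set[OF diff convex lip K z min] by simp
  with descent_in_sublevel_set[OF diff convex lip z, of "x - z"] x show ?thesis by simp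
qed

text \<open>
  The point \<open>x\<close> is not assumed to lie in the sublevel set of \<open>c\<close>, so \<open>gap_le_quadratic\<close> cannot be
  applied to it. It is applied instead to the point of the segment from \<open>z\<close> to \<open>x\<close> at which
  the gap equals \<open>e\<close>, and shows that this point is already too far from \<open>z\<close>.
\<close>

lemma gap_le_if_near_minimizer:
  fixes f :: "'a::euclidean_space \<Rightarrow> real"
  assumes diff: "\<And>x. f differentiable (at x)"
    and convex: "\<And>u v. f v \<ge> f u + inner (gradient f u) (v - u)"
    and lip: "lipschitz_gradient_below f K c" and K: "K > 0"
    and min: "\<And>x. f z \<le> f x" and e: "0 < e" "f z + e \<le> c"
    and near: "K / 2 * (norm (x - z))\<^sup>2 \<le> e"
  shows "f x - f z \<le> e"
proof (rule ccontr)
  assume far: "\<not> f x - f z \<le> e"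
  obtain s where s: "0 \<le> s" "s \<le> 1" "f (z + s *\<^sub>R (x - z)) = f z + e"
    using IVT'[of "\<lambda>s. f (z + s *\<^sub>R (x - z))" 0 "f z + e" 1] far e(1)
      continuous_on_line[OF diff] by auto
  have "s \<noteq> 1" using s(3) far by auto
  then have "s\<^sup>2 < 1" using s by (simp add: power_less_one_iff)
  have "e \<le> s\<^sup>2 * (K / 2 * (norm (x - z))\<^sup>2)"
    using gap_le_quadratic[OF diff convex lip K min, of "z + s *\<^sub>R (x - z)"] s e
    by (simp add: power_mult_distrib mult_ac)
  also have "\<dots> \<le> s\<^sup>2 * e"
    using near by (rule mult_left_mono) simp
  also have "\<dots> < e" using \<open>s\<^sup>2 < 1\<close> e(1) by simp
  finally show False by simp
qed

section \<open>Contraction of Polyak steps\<close>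

text \<open>
  The constant \<open>3 / 4\<close> collects two contributions to \<open>\<eta> * (h + \<mu> * D)\<close> with \<open>\<eta> \<ge> 1 / (2 * K)\<close>: one
  \<open>\<mu> * D\<close> is explicit, and another \<open>\<mu> / 2 * D\<close> comes from \<open>h\<close>.
\<close>

lemma polyak_step_contraction:
  fixes f :: "'a::euclidean_space \<Rightarrow> real"
  assumes diff: "\<And>x. f differentiable (at x)"
    and \<mu>: "\<mu> > 0" and convex: "strongly_convex \<mu> f"
    and lip: "lipschitz_gradient_below f K c" and K: "K > 0"
    and min: "\<And>x. f z \<le> f x" and x: "f x \<le> c"
    and y: "y = x - ((f x - f z) / (norm (gradient f x))\<^sup>2) *\<^sub>R gradient f x"
  shows "(norm (y - z))\<^sup>2 \<le> exp (- (3 * \<mu> / (4 * K))) * (norm (x - z))\<^sup>2"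
proof -
  define g where "g = gradient f x"
  define h where "h = f x - f z"
  define D where "D = (norm (x - z))\<^sup>2"
  have strong: "f v \<ge> f u + inner (gradient f u) (v - u) + \<mu> / 2 * (norm (v - u))\<^sup>2" for u v
    using convex unfolding strongly_convex_def by blast
  note convex' = strongly_convex_gradient_inequality[OF convex \<mu>]
  have "gradient f z = 0"
    using gradient_bound_in_sublevel_set[OF diff convex' lip K _ min, of z] min[of x] x by simp
  then have hD: "h \<ge> \<mu> / 2 * D"
    using strong[of z x] by (simp add: h_def D_def)
  have D0: "D \<ge> 0" by (simp add: D_def)
  have gd: "inner g (x - z) \<ge> h + \<mu> / 2 * D"
    using strong[of x z] by (simp add: h_def D_def g_def inner_diff_right norm_minus_commute)
  have g2: "(norm g)\<^sup>2 \<le> 2 * K * h"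
    using gradient_bound_in_sublevel_set[OF diff convex' lip K x min] by (simp add: g_def h_def)
  show ?thesis
  proof (cases "g = 0")
    case True
    \<comment> \<open>The step size is then \<open>h / 0 = 0\<close>, and \<open>x\<close> is the minimizer.\<close>
    then have "D = 0"
      using gd hD D0 \<mu> by (smt (verit) inner_zero_left mult_pos_pos half_gt_zero)
    then show ?thesis using True y by (simp add: g_def D_def)
  next
    case False
    define \<eta> where "\<eta> = h / (norm g)\<^sup>2"
    have gpos: "(norm g)\<^sup>2 > 0" using False by simp
    with g2 K have hpos: "h > 0" by (smt (verit) mult_pos_pos zero_less_mult_pos)
    have eta: "\<eta> \<ge> 1 / (2 * K)"
      using g2 gpos K by (simp add: \<eta>_def field_simps)
    have eta0: "\<eta> \<ge> 0" using hpos gpos by (simp add: \<eta>_def)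
    have eta_g: "\<eta> * (norm g)\<^sup>2 = h" using gpos by (simp add: \<eta>_def)
    have yz: "y - z = (x - z) - \<eta> *\<^sub>R g"
      by (simp add: y g_def h_def \<eta>_def)
    have "(norm (y - z))\<^sup>2 = D - 2 * \<eta> * inner g (x - z) + \<eta> * (\<eta> * (norm g)\<^sup>2)"
      unfolding yz D_def power2_norm_eq_inner
      by (simp add: inner_diff_left inner_diff_right inner_commute algebra_simps)
    also have "\<dots> \<le> D - 2 * \<eta> * (h + \<mu> / 2 * D) + \<eta> * h"
      using mult_left_mono[OF gd, of "2 * \<eta>"] eta0 eta_g by simp
    also have "\<dots> = D - \<eta> * (h + \<mu> * D)" by (simp add: algebra_simps)
    \<comment> \<open>Here \<open>h \<ge> \<mu> / 2 * D\<close> enters.\<close>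
    also have "\<dots> \<le> D - 1 / (2 * K) * (3 / 2 * \<mu> * D)"
    proof -
      have "3 / 2 * \<mu> * D \<le> h + \<mu> * D" using hD by (simp add: mult.commute)
      then show ?thesis
        using eta eta0 D0 \<mu> by (intro diff_left_mono mult_mono) auto
    qed
    also have "\<dots> = (1 - 3 * \<mu> / (4 * K)) * D" using K by (simp add: field_simps)
    also have "\<dots> \<le> exp (- (3 * \<mu> / (4 * K))) * D"
      using D0 exp_ge_add_one_self[of "- (3 * \<mu> / (4 * K))"] by (intro mult_right_mono) auto
    finally show ?thesis by (simp add: D_def)
  qed
qed

lemma exponential_decay:
  fixes D :: "nat \<Rightarrow> real"
  assumes "\<And>t. n \<le> t \<Longrightarrow> D (Suc t) \<le> exp (- a) * D t"
  shows "D (n + m) \<le> exp (- (a * real m)) * D n"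
proof (induction m)
  case (Suc m)
  have "D (n + Suc m) \<le> exp (- a) * D (n + m)" using assms[of "n + m"] by simp
  also have "\<dots> \<le> exp (- a) * (exp (- (a * real m)) * D n)"
    using Suc by (rule mult_left_mono) simp
  also have "\<dots> = exp (- (a * real (Suc m))) * D n"
    by (simp add: algebra_simps exp_add[symmetric])
  finally show ?case .
qed simp

section \<open>The two-phase step count\<close>

theorem theorem3:
  fixes f :: "real ^ 'd \<Rightarrow> real"
    and L Ls \<delta> \<mu> \<epsilon> fstar :: real
    and wstar :: "real ^ 'd"
    and w :: "nat \<Rightarrow> real ^ 'd"
    and \<eta> :: "nat \<Rightarrow> real"
    and T :: nat
  assumes differentiable: "\<And>x. f differentiable (at x)"
    and pos: "L > 0" "Ls > 0" "\<delta> > 0"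
    and smooth: "glocally_smooth f L Ls \<delta>"
    and convex: "\<mu> > 0" "strongly_convex \<mu> f"
    and minimizer: "\<And>x. f wstar \<le> f x" "fstar = f wstar"
    and gap: "f (w 0) - fstar > \<delta>" "\<delta> > \<epsilon>" "\<epsilon> > 0"
    and step_size: "\<And>t. \<eta> t = (f (w t) - fstar) / (norm (gradient f (w t)))\<^sup>2"
    and step: "\<And>t. w (Suc t) = w t - \<eta> t *\<^sub>R gradient f (w t)"
    and T: "real T \<ge> 4 * (L / \<mu> * ln (L / 2 * ((norm (w 0 - wstar))\<^sup>2 / \<delta>))
                        + Ls / \<mu> * ln (Ls / L * (\<delta> / \<epsilon>))) + 1"
  shows "f (w T) - fstar \<le> \<epsilon>"
proof -
  have inf: "(INF x. f x) = fstar"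
    using minimizer by (auto intro!: cInf_eq_minimum)
  have global: "lipschitz_gradient_below f L c" for c
    using smooth unfolding glocally_smooth_def lipschitz_gradient_below_def by blast
  have local: "lipschitz_gradient_below f Ls (fstar + \<delta>)"
    using smooth unfolding glocally_smooth_def lipschitz_gradient_below_def inf
    by (auto simp: algebra_simps)
  note convex' = strongly_convex_gradient_inequality[OF convex(2,1)]
  define D where "D = (\<lambda>t. (norm (w t - wstar))\<^sup>2)"
  define A where "A = L * D 0 / (2 * \<delta>)"
  define x where "x = Ls * \<delta> / (L * \<epsilon>)"
  define r where "r = Ls / L"
  define a where "a = 3 * \<mu> / (4 * L)"
  define b where "b = 3 * \<mu> / (4 * Ls)"
  have ab: "a > 0" "b > 0" "a = r * b" "r > 0"
    using pos convex(1) by (auto simp: a_def b_def r_def)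
  have step': "w (Suc t) = w t - ((f (w t) - f wstar) / (norm (gradient f (w t)))\<^sup>2)
      *\<^sub>R gradient f (w t)" for t
    using step step_size minimizer(2) by simp
  have decay_a: "D (n + m) \<le> exp (- (a * real m)) * D n" for n m
    using polyak_step_contraction[OF differentiable convex global pos(1) minimizer(1) order_refl step']
    by (intro exponential_decay) (auto simp: D_def a_def)
  have D_mono: "D t \<le> D n" if "n \<le> t" for n t
  proof -
    have "D t \<le> exp (- (a * real (t - n))) * D n" using decay_a[of n "t - n"] that by simp
    also have "\<dots> \<le> 1 * D n" using ab by (intro mult_right_mono) (auto simp: D_def)
    finally show ?thesis by simp
  qed
  \<comment> \<open>A point closer than this would have gap at most \<open>\<delta>\<close>.\<close>
  have D0: "D 0 > 2 * \<delta> / Ls"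
    using gap_le_if_near_minimizer[OF differentiable convex' local pos(2) minimizer(1) pos(3), of "w 0"]
      gap(1) minimizer(2) pos(2) by (simp add: D_def field_simps) argo
  then have D0_pos: "D 0 > 0"
    using pos by (smt (verit) divide_pos_pos)
  have gap_L: "f (w t) - fstar \<le> L / 2 * D t" for t
    using gap_le_quadratic[OF differentiable convex' global pos(1) minimizer(1) order_refl]
      minimizer(2) by (simp add: D_def)
  have A: "A > 1" using gap_L[of 0] gap(1) pos by (simp add: A_def field_simps)
  have xpos: "x > 0" using pos gap by (simp add: x_def)
  have T': "real T \<ge> 3 * ln A / a + 3 * ln x / b + 1"
    using T pos convex(1) by (simp add: A_def x_def a_def b_def D_def field_simps)
  have target: "(D 0 / A) / x = 2 * \<epsilon> / Ls"
    using pos gap A D0_pos by (simp add: A_def x_def field_simps)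
  have "D T \<le> (D 0 / A) / x"
  proof (cases "x \<ge> 1")
    case True
    \<comment> \<open>The first phase ends after \<open>n\<close> steps; rounding up costs at most one step, which is the
      \<open>1\<close> in the bound on \<open>T\<close>.\<close>
    define n where "n = nat \<lceil>ln A / a\<rceil>"
    have n: "ln A / a \<le> real n" "real n \<le> ln A / a + 1"
      using A ab by (auto simp: n_def)
    have nT: "real T - real n \<ge> ln x / b" "n \<le> T"
    proof -
      have "ln A / a \<ge> 0" "ln x / b \<ge> 0" using A True ab by auto
      then show "real T - real n \<ge> ln x / b" using T' n(2) by simp
      with \<open>ln x / b \<ge> 0\<close> show "n \<le> T" by simp
    qed
    have "D n \<le> exp (- (a * real n)) * D 0" using decay_a[of 0 n] by simp
    also have "\<dots> \<le> exp (- ln A) * D 0"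
      using n(1) ab by (intro mult_right_mono) (auto simp: D_def field_simps)
    also have "\<dots> = D 0 / A" using A by (simp add: exp_minus field_simps)
    finally have Dn: "D n \<le> D 0 / A" .
    have below: "f (w t) \<le> fstar + \<delta>" if "n \<le> t" for t
    proof -
      have "L / 2 * D t \<le> L / 2 * (D 0 / A)"
        using D_mono[OF that] Dn pos by (intro mult_left_mono) auto
      also have "\<dots> = \<delta>" using pos A D0_pos by (simp add: A_def field_simps)
      finally show ?thesis using gap_L[of t] by simp
    qed
    have "D (n + (T - n)) \<le> exp (- (b * real (T - n))) * D n"
      using polyak_step_contraction[OF differentiable convex local pos(2) minimizer(1) below step']
      by (intro exponential_decay) (auto simp: D_def b_def)
    also have "\<dots> \<le> exp (- ln x) * (D 0 / A)"
      using nT ab Dn by (intro mult_mono) (auto simp: D_def field_simps)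
    also have "\<dots> = (D 0 / A) / x" using xpos by (simp add: exp_minus field_simps)
    finally show ?thesis using nT(2) by simp
  next
    case False
    \<comment> \<open>The required exponent is \<open>ln A + ln x\<close>, and \<open>a * T\<close> is at least \<open>3 * ln A + 3 * r * ln x\<close>.
      The difference is \<open>2 * ln A + (3 * r - 1) * ln x\<close>, at least \<open>- 3 * (1 - r) * ln x \<ge> 0\<close> since
      \<open>ln A \<ge> - ln r \<ge> - ln x\<close>.\<close>
    have r: "r < 1" "1 / r \<le> A" "r \<le> x"
    proof -
      have "r * 1 \<le> r * (\<delta> / \<epsilon>)"
        using ab gap by (intro mult_left_mono) auto
      then show "r \<le> x" by (simp add: r_def x_def)
      then show "r < 1" using False by simp
      show "1 / r \<le> A" using D0 pos by (simp add: r_def A_def field_simps)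
    qed
    have "- ln r \<le> ln A"
      using r(2) ab A by (subst ln_inverse[symmetric]) (auto simp: field_simps)
    moreover have "ln r \<le> ln x" using r(3) ab by simp
    ultimately have A_x: "- ln x \<le> ln A" by simp
    have "ln x \<le> 0" using False xpos by simp
    then have "ln x \<le> r * ln x" using r(1) by (simp add: mult_le_cancel_right1)
    have "ln A + ln x \<le> a * real T"
    proof -
      have "a * (3 * ln A / a + 3 * ln x / b + 1) = 3 * ln A + 3 * (r * ln x) + a"
        using ab by (simp add: field_simps)
      moreover have "a * (3 * ln A / a + 3 * ln x / b + 1) \<le> a * real T"
        using T' ab by (intro mult_left_mono) auto
      ultimately show ?thesis
        using A_x \<open>ln x \<le> r * ln x\<close> ab(1) by linarith
    qed
    have "D T \<le> exp (- (a * real T)) * D 0" using decay_a[of 0 T] by simp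
    also have "\<dots> \<le> exp (- (ln A + ln x)) * D 0"
      using \<open>ln A + ln x \<le> a * real T\<close> by (intro mult_right_mono) (auto simp: D_def)
    also have "\<dots> = (D 0 / A) / x"
      using A xpos by (simp add: exp_minus exp_diff field_simps exp_add)
    finally show ?thesis .
  qed
  then have "Ls / 2 * D T \<le> \<epsilon>"
    using pos unfolding target by (simp add: field_simps)
  then show ?thesis
    using gap_le_if_near_minimizer[OF differentiable convex' local pos(2) minimizer(1) gap(3)]
      gap minimizer(2) by (simp add: D_def)
qed

end
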